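(* Let $f \in L^1[-\pi,\pi]$, and let its Fourier coefficients be $$a_n := \frac{1}{\pi}\int_{-\pi}^{\pi} f(t)\cos nt \, dt \quad (n \geq 0), \qquad b_n := \frac{1}{\pi}\int_{-\pi}^{\pi} f(t)\sin nt \, dt \quad (n > 0),$$ where $n$ ranges over integers. If $a_n = 0$ for all integers $n \geq 0$ and $b_n = 0$ for all integers $n > 0$, then $f = 0$ almost everywhere on $[-\pi,\pi]$.
   Context: $L^1[-\pi,\pi]$ denotes the space of Lebesgue integrable functions on the interval $[-\pi,\pi]$; integrals and "almost everywhere" are with respect to Lebesgue measure. *)

theory Defs
  imports "HOL-Analysis.Analysis"
begin

(* The only instances of the class {real_normed_field, euclidean_space} up to isomorphism are
   the scalar fields real and complex, so both readings of L^1 are covered.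
   lebesgue is the completed Lebesgue measure. The integrals are Bochner integrals, which for
   these scalars are the usual Lebesgue integrals. *)

definition fourier_cos_coeff :: "(real \<Rightarrow> 'a::{real_normed_field, euclidean_space}) \<Rightarrow> nat \<Rightarrow> 'a"
  where "fourier_cos_coeff f n =
    of_real (1 / pi) * (LINT t:{-pi..pi}|lebesgue. f t * of_real (cos (real n * t)))"

definition fourier_sin_coeff :: "(real \<Rightarrow> 'a::{real_normed_field, euclidean_space}) \<Rightarrow> nat \<Rightarrow> 'a"
  where "fourier_sin_coeff f n =
    of_real (1 / pi) * (LINT t:{-pi..pi}|lebesgue. f t * of_real (sin (real n * t)))"

end

theory Submission
  imports Defs
begin

text \<open>Extend \<open>f\<close> by zero to an integrable \<open>F\<close> on the line. The hypotheses say that \<open>F\<close> integrates to zero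
  against every trigonometric polynomial. These are dense among the continuous functions on the
  circle (\<open>trig_poly_dense_on_circle\<close>, by Stone-Weierstrass), and \<open>F\<close> is integrable, so \<open>F\<close>
  integrates to zero against every continuous function on the circle. The indicator of a compact
  set is a dominated pointwise limit of such functions, so the integral of \<open>F\<close> over every compact
  set vanishes (\<open>compact_integral_zero\<close>).

  Inner regularity of Lebesgue measure finishes the proof without Fejer kernels or Lebesgue points:
  if a component of \<open>F\<close> were positive on a set of positive measure, then it would be positive on
  a compact set of positive measure and have a nonzero integral there
  (\<open>AE_zero_if_compact_integrals_zero\<close>). Working with components, and testing both signs of each,
  treats real and complex scalars alike.\<close>

section \<open>Trigonometric polynomials\<close>

text \<open>Allowing a phase makes one generator per frequency suffice and reduces closure under products
  to a single product-to-sum identity; integer frequencies absorb the difference of two frequencies.\<close>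

inductive trig_poly :: "(real \<Rightarrow> real) \<Rightarrow> bool" where
  cos: "trig_poly (\<lambda>t. c * cos (real_of_int n * t + d))"
| add: "trig_poly g \<Longrightarrow> trig_poly h \<Longrightarrow> trig_poly (\<lambda>t. g t + h t)"

lemma trig_poly_const: "trig_poly (\<lambda>t. c)"
  using trig_poly.cos[of c 0 0] by simp

lemma trig_poly_mult:
  assumes "trig_poly g" "trig_poly h"
  shows "trig_poly (\<lambda>t. g t * h t)"
  using assms(1)
proof induction
  case (cos c n d)
  show ?case
    using assms(2)
  proof induction
    case (cos c' n' d')
    have "(\<lambda>t. c * cos (real_of_int n * t + d) * (c' * cos (real_of_int n' * t + d'))) =
      (\<lambda>t. (c * c' / 2) * cos (real_of_int (n - n') * t + (d - d'))
         + (c * c' / 2) * cos (real_of_int (n + n') * t + (d + d')))"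
    proof
      fix t
      have "c * cos (real_of_int n * t + d) * (c' * cos (real_of_int n' * t + d')) =
        c * c' * (cos (real_of_int n * t + d) * cos (real_of_int n' * t + d'))"
        by simp
      also have "\<dots> = c * c' * ((cos (real_of_int n * t + d - (real_of_int n' * t + d'))
          + cos (real_of_int n * t + d + (real_of_int n' * t + d'))) / 2)"
        by (simp only: cos_times_cos)
      also have "real_of_int n * t + d - (real_of_int n' * t + d')
          = real_of_int (n - n') * t + (d - d')"
        by (simp add: algebra_simps)
      also have "real_of_int n * t + d + (real_of_int n' * t + d')
          = real_of_int (n + n') * t + (d + d')"
        by (simp add: algebra_simps)
      finally show "c * cos (real_of_int n * t + d) * (c' * cos (real_of_int n' * t + d')) =
         (c * c' / 2) * cos (real_of_int (n - n') * t + (d - d'))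
         + (c * c' / 2) * cos (real_of_int (n + n') * t + (d + d'))"
        by (simp add: algebra_simps)
    qed
    then show ?case
      by (simp only:) (rule trig_poly.add[OF trig_poly.cos trig_poly.cos])
  next
    case (add g h)
    then show ?case
      using trig_poly.add[OF add.IH] by (simp add: distrib_left)
  qed
next
  case (add g h)
  then show ?case
    using trig_poly.add[OF add.IH] by (simp add: distrib_right)
qed

lemma trig_poly_continuous: "trig_poly g \<Longrightarrow> continuous_on UNIV g"
  by (induction rule: trig_poly.induct) (intro continuous_intros; assumption)+

lemma trig_poly_bounded: "trig_poly g \<Longrightarrow> \<exists>B. \<forall>t. \<bar>g t\<bar> \<le> B"
proof (induction rule: trig_poly.induct)
  case (cos c n d)
  have "\<bar>c * cos (real_of_int n * t + d)\<bar> \<le> \<bar>c\<bar> * 1" for t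
    unfolding abs_mult by (intro mult_left_mono) auto
  then show ?case by blast
next
  case (add g h)
  then obtain A B where "\<And>t. \<bar>g t\<bar> \<le> A" "\<And>t. \<bar>h t\<bar> \<le> B" by blast
  then have "\<bar>g t + h t\<bar> \<le> A + B" for t
    by (meson abs_triangle_ineq add_mono order_trans)
  then show ?case by blast
qed

text \<open>The circle, rather than the interval, is the right compact space here: trigonometric
  polynomials take the same value at both ends of the interval, so they separate points only after
  the ends are glued.\<close>

lemma trig_poly_dense_on_circle:
  fixes \<phi> :: "complex \<Rightarrow> real"
  assumes "continuous_on (sphere 0 1) \<phi>" "e > 0"
  shows "\<exists>g. trig_poly g \<and> (\<forall>t. \<bar>\<phi> (cis t) - g t\<bar> < e)"
proof -
  let ?P = "\<lambda>\<psi>. continuous_on (sphere 0 1) \<psi> \<and> trig_poly (\<lambda>t. \<psi> (cis t))"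
  have Re: "?P Re"
    using trig_poly.cos[of 1 1 0] by (auto intro!: continuous_intros)
  have Im: "?P Im"
    using trig_poly.cos[of 1 1 "- (pi/2)"] by (auto intro!: continuous_intros simp: cos_diff)
  have "\<exists>\<psi>. ?P \<psi> \<and> (\<forall>z\<in>sphere 0 1. \<bar>\<phi> z - \<psi> z\<bar> < e)"
  proof (rule Stone_Weierstrass_HOL)
    fix x y :: complex
    assume "x \<in> sphere 0 1 \<and> y \<in> sphere 0 1 \<and> x \<noteq> y"
    then show "\<exists>\<psi>. ?P \<psi> \<and> \<psi> x \<noteq> \<psi> y"
      using Re Im complex_eq_iff by blast
  next
    show "?P (\<lambda>z. c)" for c
      using trig_poly_const by simp
  next
    fix \<psi> \<omega> assume P: "?P \<psi> \<and> ?P \<omega>"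
    then show "?P (\<lambda>z. \<psi> z + \<omega> z)"
      using trig_poly.add[of "\<lambda>t. \<psi> (cis t)" "\<lambda>t. \<omega> (cis t)"] by (simp add: continuous_on_add)
    show "?P (\<lambda>z. \<psi> z * \<omega> z)"
      using P trig_poly_mult[of "\<lambda>t. \<psi> (cis t)" "\<lambda>t. \<omega> (cis t)"] by (simp add: continuous_on_mult)
  qed (use assms in auto)
  then obtain \<psi> where "?P \<psi>" "\<forall>z\<in>sphere 0 1. \<bar>\<phi> z - \<psi> z\<bar> < e" by blast
  then show ?thesis
    by (intro exI[of _ "\<lambda>t. \<psi> (cis t)"]) auto
qed

section \<open>Functions annihilated by all trigonometric polynomials\<close>

lemma integrable_continuous_bounded_scaleR:
  fixes F :: "real \<Rightarrow> 'a::euclidean_space" and g :: "real \<Rightarrow> real"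
  assumes F: "integrable lebesgue F" and g: "continuous_on UNIV g" and B: "\<And>t. \<bar>g t\<bar> \<le> B"
  shows "integrable lebesgue (\<lambda>t. g t *\<^sub>R F t)"
proof (rule Bochner_Integration.integrable_bound)
  show "integrable lebesgue (\<lambda>t. B *\<^sub>R F t)"
    using F by simp
  have "g \<in> borel_measurable lebesgue"
    using borel_measurable_continuous_onI[OF g] by (intro measurable_completion) simp
  then show "(\<lambda>t. g t *\<^sub>R F t) \<in> borel_measurable lebesgue"
    using F by (intro borel_measurable_scaleR) auto
  have "\<bar>g t\<bar> * norm (F t) \<le> \<bar>B\<bar> * norm (F t)" for t
    using B[of t] by (intro mult_right_mono) auto
  then show "AE t in lebesgue. norm (g t *\<^sub>R F t) \<le> norm (B *\<^sub>R F t)"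
    by simp
qed

lemma trig_poly_integral_zero:
  fixes F :: "real \<Rightarrow> 'a::euclidean_space"
  assumes F: "integrable lebesgue F"
    and zero: "\<And>n d. (LINT t|lebesgue. cos (real_of_int n * t + d) *\<^sub>R F t) = 0"
    and "trig_poly g"
  shows "(LINT t|lebesgue. g t *\<^sub>R F t) = 0"
  using assms(3)
proof induction
  case (cos c n d)
  then show ?case
    using zero[of n d] by (simp flip: scaleR_scaleR)
next
  case (add g h)
  have "integrable lebesgue (\<lambda>t. g t *\<^sub>R F t)" if "trig_poly g" for g
    using integrable_continuous_bounded_scaleR[OF F] trig_poly_continuous trig_poly_bounded that
    by metis
  with add show ?case
    by (simp add: scaleR_add_left)
qed

lemma circle_function_integral_zero:
  fixes F :: "real \<Rightarrow> 'a::euclidean_space" and \<phi> :: "complex \<Rightarrow> real"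
  assumes F: "integrable lebesgue F"
    and zero: "\<And>n d. (LINT t|lebesgue. cos (real_of_int n * t + d) *\<^sub>R F t) = 0"
    and \<phi>: "continuous_on (sphere 0 1) \<phi>"
  shows "(LINT t|lebesgue. \<phi> (cis t) *\<^sub>R F t) = 0"
proof -
  let ?N = "LINT t|lebesgue. norm (F t)"
  have cont: "continuous_on UNIV (\<lambda>t. \<phi> (cis t))"
    by (rule continuous_on_compose2[OF \<phi>]) (auto intro!: continuous_intros)
  have "compact (\<phi> ` sphere 0 1)"
    using \<phi> by (intro compact_continuous_image) auto
  then obtain B where "\<And>z. z \<in> sphere 0 1 \<Longrightarrow> \<bar>\<phi> z\<bar> \<le> B"
    by (metis bounded_iff compact_imp_bounded image_eqI real_norm_def)
  then have B: "\<bar>\<phi> (cis t)\<bar> \<le> B" for t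
    by simp
  have int_\<phi>: "integrable lebesgue (\<lambda>t. \<phi> (cis t) *\<^sub>R F t)"
    using integrable_continuous_bounded_scaleR[OF F cont B] .
  have bound: "norm (LINT t|lebesgue. \<phi> (cis t) *\<^sub>R F t) \<le> e * ?N" if "e > 0" for e
  proof -
    obtain g where g: "trig_poly g" "\<And>t. \<bar>\<phi> (cis t) - g t\<bar> < e"
      using trig_poly_dense_on_circle[OF \<phi> \<open>e > 0\<close>] by blast
    obtain C where C: "\<And>t. \<bar>g t\<bar> \<le> C"
      using trig_poly_bounded[OF g(1)] by blast
    have int_g: "integrable lebesgue (\<lambda>t. g t *\<^sub>R F t)"
      using integrable_continuous_bounded_scaleR[OF F trig_poly_continuous[OF g(1)] C] .
    have "(LINT t|lebesgue. \<phi> (cis t) *\<^sub>R F t)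
        = (LINT t|lebesgue. \<phi> (cis t) *\<^sub>R F t - g t *\<^sub>R F t)"
      using trig_poly_integral_zero[OF F zero g(1)] int_\<phi> int_g by simp
    also have "norm \<dots> \<le> (LINT t|lebesgue. e * norm (F t))"
    proof (rule Bochner_Integration.integral_norm_bound_integral)
      fix t
      have "\<bar>\<phi> (cis t) - g t\<bar> * norm (F t) \<le> e * norm (F t)"
        using g(2)[of t] by (intro mult_right_mono) auto
      then show "norm (\<phi> (cis t) *\<^sub>R F t - g t *\<^sub>R F t) \<le> e * norm (F t)"
        by (simp flip: scaleR_diff_left)
    qed (use F int_\<phi> int_g in auto)
    finally show ?thesis by simp
  qed
  have "norm (LINT t|lebesgue. \<phi> (cis t) *\<^sub>R F t) \<le> 0 + e" if "e > 0" for e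
  proof -
    have "?N \<ge> 0" by simp
    then have N: "?N + 1 > 0" by linarith
    have "norm (LINT t|lebesgue. \<phi> (cis t) *\<^sub>R F t) \<le> e / (?N + 1) * ?N"
      using N that by (intro bound divide_pos_pos)
    also have "\<dots> \<le> e"
      using N that by (simp add: field_simps)
    finally show ?thesis by simp
  qed
  then show ?thesis
    using field_le_epsilon by (metis norm_le_zero_iff)
qed

text \<open>On the circle the indicator of a compact set is the decreasing pointwise limit of the continuous
  tent functions \<open>max 0 (1 - k * setdist {z} S)\<close>. Pulling back along \<open>cis\<close> is faithful except
  at the two ends of the interval, a null set.\<close>

lemma compact_integral_zero:
  fixes F :: "real \<Rightarrow> 'a::euclidean_space"
  assumes F: "integrable lebesgue F"
    and zero: "\<And>n d. (LINT t|lebesgue. cos (real_of_int n * t + d) *\<^sub>R F t) = 0"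
    and supp: "\<And>t. t \<notin> {-pi..pi} \<Longrightarrow> F t = 0"
    and K: "compact K"
  shows "(LINT t:K|lebesgue. F t) = 0"
proof -
  \<comment> \<open>The extra point does not affect integrals; it keeps the set nonempty, as \<open>setdist\<close> to the empty
    set is zero.\<close>
  define S where "S = cis ` insert pi (K \<inter> {-pi..pi})"
  have "compact S"
    unfolding S_def using K
    by (intro compact_continuous_image compact_insert compact_Int) (auto intro!: continuous_intros)
  then have S: "closed S" "S \<noteq> {}"
    by (auto simp: compact_imp_closed S_def)
  define \<phi> where "\<phi> k z = max 0 (1 - real k * setdist {z} S)" for k z
  have \<phi>_bounds: "0 \<le> \<phi> k z" "\<phi> k z \<le> 1" for k z
    by (auto simp: \<phi>_def)
  have cont: "continuous_on A (\<phi> k)" for k A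
    unfolding \<phi>_def by (intro continuous_intros)
  have lim: "(\<lambda>k. \<phi> k z) \<longlonglongrightarrow> indicator S z" for z
  proof (cases "z \<in> S")
    case True
    then have "\<phi> k z = 1" for k
      by (simp add: \<phi>_def setdist_sing_in_set)
    with True show ?thesis by simp
  next
    case False
    then have "setdist {z} S > 0"
      using S by (simp add: setdist_gt_0_compact_closed)
    then obtain m where m: "real m * setdist {z} S > 1"
      using reals_Archimedean3 by blast
    have "\<phi> k z = 0" if "k \<ge> m" for k
    proof -
      have "real m * setdist {z} S \<le> real k * setdist {z} S"
        using that by (intro mult_right_mono) auto
      with m show ?thesis by (simp add: \<phi>_def)
    qed
    then show ?thesis
      using False by (intro tendsto_eventually) (auto simp: eventually_sequentially)
  qed
  have ends: "AE t in lebesgue. t \<noteq> -pi \<and> t \<noteq> pi"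
    by (intro AE_conjI AE_completion AE_lborel_singleton)
  have pullback: "indicator S (cis t) *\<^sub>R F t = indicator K t *\<^sub>R F t"
    if "t \<noteq> -pi \<and> t \<noteq> pi" for t
  proof (cases "t \<in> {-pi..pi}")
    case True
    have "cis t \<in> S \<longleftrightarrow> t \<in> K"
    proof
      assume "cis t \<in> S"
      then obtain s where s: "s \<in> insert pi (K \<inter> {-pi..pi})" "cis t = cis s"
        unfolding S_def by blast
      have "Arg (cis t) = t"
        using True that by (intro cis_Arg_unique) auto
      moreover have "Arg (cis s) = s \<or> s = -pi"
        using s(1) by (cases "s = -pi") (auto intro!: cis_Arg_unique)
      moreover have "Arg (cis pi) = pi"
        by (intro cis_Arg_unique) auto
      moreover have "cis (-pi) = cis pi"
        by (simp add: complex_eq_iff)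
      ultimately have "t = s"
        using s(2) that by metis
      with s(1) that show "t \<in> K" by auto
    qed (use True in \<open>auto simp: S_def\<close>)
    then show ?thesis by (simp add: indicator_def)
  qed (simp add: supp)
  have "K \<in> sets lebesgue"
    using K by (simp add: compact_imp_closed lmeasurable_compact fmeasurableD)
  have "(\<lambda>k. LINT t|lebesgue. \<phi> k (cis t) *\<^sub>R F t)
      \<longlonglongrightarrow> (LINT t|lebesgue. indicator K t *\<^sub>R F t)"
  proof (rule integral_dominated_convergence)
    show "integrable lebesgue (\<lambda>t. norm (F t))"
      using F by simp
    show "(\<lambda>t. indicat_real K t *\<^sub>R F t) \<in> borel_measurable lebesgue"
      using F \<open>K \<in> sets lebesgue\<close>
      by (intro borel_measurable_scaleR borel_measurable_indicator) auto
    fix k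
    have "continuous_on UNIV (\<lambda>t. \<phi> k (cis t))"
      by (rule continuous_on_compose2[OF cont[of UNIV]]) (auto intro!: continuous_intros)
    moreover have "\<bar>\<phi> k (cis t)\<bar> \<le> 1" for t
      using \<phi>_bounds[of k "cis t"] by simp
    ultimately show "(\<lambda>t. \<phi> k (cis t) *\<^sub>R F t) \<in> borel_measurable lebesgue"
      by (rule borel_measurable_integrable[OF integrable_continuous_bounded_scaleR[OF F]])
    show "AE t in lebesgue. norm (\<phi> k (cis t) *\<^sub>R F t) \<le> norm (F t)"
      using \<phi>_bounds by (auto intro!: AE_I2 mult_left_le_one_le)
  next
    show "AE t in lebesgue. (\<lambda>k. \<phi> k (cis t) *\<^sub>R F t) \<longlonglongrightarrow> indicat_real K t *\<^sub>R F t"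
      using ends
    proof eventually_elim
      case (elim t)
      show ?case
        using tendsto_scaleR[OF lim[of "cis t"] tendsto_const[of "F t"]] pullback[OF elim] by simp
    qed
  qed
  moreover have "(LINT t|lebesgue. \<phi> k (cis t) *\<^sub>R F t) = 0" for k
    by (rule circle_function_integral_zero[OF F zero cont])
  ultimately show ?thesis
    by (simp add: set_lebesgue_integral_def LIMSEQ_const_iff)
qed

section \<open>Vanishing almost everywhere\<close>

text \<open>The set where \<open>h\<close> is positive is, up to a null set, a countable union of compact sets,
  and on each of them a positive function with zero integral forces measure zero.\<close>

lemma null_positive_part:
  fixes h :: "'a::euclidean_space \<Rightarrow> real"
  assumes h: "integrable lebesgue h"
    and zero: "\<And>K. compact K \<Longrightarrow> (LINT x:K|lebesgue. h x) = 0"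
  shows "AE x in lebesgue. h x \<le> 0"
proof -
  have "{x \<in> space lebesgue. 0 < h x} \<in> sets lebesgue"
    using h by (intro borel_measurable_less) auto
  then have pos: "{x. h x > 0} \<in> sets lebesgue"
    by simp
  then obtain C T where C: "fsigma C" and T: "T \<in> null_sets lebesgue"
    and CT: "C \<union> T = {x. h x > 0}"
    using lebesgue_set_almost_fsigma[OF pos] by metis
  obtain D :: "nat \<Rightarrow> 'a set" where D: "\<And>i. compact (D i)" "C = (\<Union>i. D i)"
    using C[unfolded fsigma_Union_compact] by (metis image_subset_iff UNIV_I mem_Collect_eq)
  have "D i \<in> null_sets lebesgue" for i
  proof (rule null_if_pos_func_has_zero_int[OF h])
    show "D i \<in> sets lebesgue"
      using D(1) by (simp add: lmeasurable_compact fmeasurableD)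
    show "AE x\<in>D i in lebesgue. 0 < h x"
      using D(2) CT by (intro AE_I2) blast
  qed (use zero D(1) in simp)
  then have "C \<union> T \<in> null_sets lebesgue"
    using T D(2) by auto
  then show ?thesis
    unfolding CT by (rule AE_I') auto
qed

lemma AE_zero_if_compact_integrals_zero:
  fixes F :: "'a::euclidean_space \<Rightarrow> 'b::euclidean_space"
  assumes F: "integrable lebesgue F"
    and zero: "\<And>K. compact K \<Longrightarrow> (LINT x:K|lebesgue. F x) = 0"
  shows "AE x in lebesgue. F x = 0"
proof -
  have nonpos: "AE x in lebesgue. F x \<bullet> c \<le> 0" for c
  proof (rule null_positive_part)
    fix K :: "'a set" assume K: "compact K"
    then have "integrable lebesgue (\<lambda>x. indicat_real K x *\<^sub>R F x)"
      using F by (intro integrable_mult_indicator) (auto simp: lmeasurable_compact fmeasurableD)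
    then have "(LINT x|lebesgue. (indicat_real K x *\<^sub>R F x) \<bullet> c) = 0"
      using zero[OF K] by (simp add: set_lebesgue_integral_def del: inner_scaleR_left)
    then show "(LINT x:K|lebesgue. F x \<bullet> c) = 0"
      by (simp add: set_lebesgue_integral_def)
  qed (use F in simp)
  have "AE x in lebesgue. \<forall>b\<in>Basis. F x \<bullet> b = 0"
  proof (rule AE_finite_allI)
    fix b :: 'b
    show "AE x in lebesgue. F x \<bullet> b = 0"
      using nonpos[of b] nonpos[of "- b"] by eventually_elim simp
  qed simp
  then show ?thesis
    by eventually_elim (simp add: euclidean_all_zero_iff)
qed

section \<open>Uniqueness of Fourier coefficients\<close>

theorem mainTheorem1:
  fixes f :: "real \<Rightarrow> 'a::{real_normed_field, euclidean_space}"
  assumes "set_integrable lebesgue {-pi..pi} f"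
    and "\<And>n. fourier_cos_coeff f n = 0"
    and "\<And>n. n > 0 \<Longrightarrow> fourier_sin_coeff f n = 0"
  shows "AE t\<in>{-pi..pi} in lebesgue. f t = 0"
proof -
  define F where "F = (\<lambda>t. indicat_real {-pi..pi} t *\<^sub>R f t)"
  have F: "integrable lebesgue F"
    using assms(1) by (simp add: F_def set_integrable_def)
  have int_cos: "integrable lebesgue (\<lambda>t. cos (real n * t) *\<^sub>R F t)" for n
    by (rule integrable_continuous_bounded_scaleR[OF F, of _ 1]) (auto intro!: continuous_intros)
  have int_sin: "integrable lebesgue (\<lambda>t. sin (real n * t) *\<^sub>R F t)" for n
    by (rule integrable_continuous_bounded_scaleR[OF F, of _ 1]) (auto intro!: continuous_intros)
  have cos0: "(LINT t|lebesgue. cos (real n * t) *\<^sub>R F t) = 0" for n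
  proof -
    have "(LINT t:{-pi..pi}|lebesgue. f t * of_real (cos (real n * t))) = 0"
      using assms(2)[of n] by (simp add: fourier_cos_coeff_def)
    then show ?thesis
      unfolding set_lebesgue_integral_def F_def
      by (simp only: mult.commute[of "f _"] scaleR_conv_of_real mult.left_commute)
  qed
  have sin0: "(LINT t|lebesgue. sin (real n * t) *\<^sub>R F t) = 0" for n
  proof -
    have "(LINT t:{-pi..pi}|lebesgue. f t * of_real (sin (real n * t))) = 0"
      using assms(3)[of n] by (cases "n = 0") (simp_all add: fourier_sin_coeff_def)
    then show ?thesis
      unfolding set_lebesgue_integral_def F_def
      by (simp only: mult.commute[of "f _"] scaleR_conv_of_real mult.left_commute)
  qed
  have nat0: "(LINT t|lebesgue. cos (real n * t + d) *\<^sub>R F t) = 0" for n d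
  proof -
    have "(LINT t|lebesgue. cos (real n * t + d) *\<^sub>R F t)
        = (LINT t|lebesgue. cos d *\<^sub>R (cos (real n * t) *\<^sub>R F t)
            - sin d *\<^sub>R (sin (real n * t) *\<^sub>R F t))"
      by (intro Bochner_Integration.integral_cong) (simp_all add: cos_add algebra_simps)
    also have "\<dots> = 0"
      using int_cos int_sin cos0 sin0 by (simp del: scaleR_scaleR)
    finally show ?thesis .
  qed
  have zero: "(LINT t|lebesgue. cos (real_of_int n * t + d) *\<^sub>R F t) = 0" for n d
  proof (cases n rule: int_cases2)
    case (nonneg m)
    then show ?thesis using nat0[of m d] by simp
  next
    case (nonpos m)
    have "cos (real_of_int n * t + d) = cos (real m * t + - d)" for t
      using cos_minus[of "real m * t + - d"] by (simp add: nonpos)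
    then show ?thesis using nat0[of m "- d"] by simp
  qed
  have "AE t in lebesgue. F t = 0"
  proof (rule AE_zero_if_compact_integrals_zero[OF F])
    show "(LINT t:K|lebesgue. F t) = 0" if "compact K" for K
      by (rule compact_integral_zero[OF F zero _ that]) (simp add: F_def)
  qed
  then show ?thesis
    by eventually_elim (auto simp: F_def indicator_def)
qed

end
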